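(* Let $G$ be a 2-generated finite group. Then $\Sigma(G)$ has an isolated vertex if and only if one of the following holds: (1) $G$ is cyclic; (2) $G\cong C_2\times C_2$; (3) $G\cong D_p$ is a dihedral group with $2p$ elements, for $p$ an odd prime.
   Context: A group is 2-generated if it can be generated by two elements (cyclic groups are included). For a 2-generated finite group $G$, let $V(G)$ be the set of $x\in G$ such that $G=\langle x,y\rangle$ for some $y\in G$. The graph $\Sigma(G)$ is the simple graph with vertex set $V(G)$ in which two distinct vertices $x,y$ are adjacent if and only if $\langle x,y\rangle\neq G$. An isolated vertex is a vertex with no neighbours. $C_n$ is the cyclic group of order $n$. *)

theory Defs
  imports
    "HOL-Algebra.Elementary_Groups"
    "HOL-Computational_Algebra.Primes"
    "Graph_Theory.Pair_Digraph"
begin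

definition two_generated :: "('a, 'b) monoid_scheme \<Rightarrow> bool" where
  "two_generated G \<longleftrightarrow>
     (\<exists>x\<in>carrier G. \<exists>y\<in>carrier G. generate G {x, y} = carrier G)"

definition generating_pair_elements :: "('a, 'b) monoid_scheme \<Rightarrow> 'a set" where
  "generating_pair_elements G =
     {x \<in> carrier G. \<exists>y\<in>carrier G. generate G {x, y} = carrier G}"

text \<open>
  As everywhere in \<^theory>\<open>Graph_Theory.Pair_Digraph\<close>, a simple graph is a loop-free symmetric
  digraph without parallel arcs: each edge is represented by its two orientations.
\<close>

definition sigma_graph :: "('a, 'b) monoid_scheme \<Rightarrow> 'a pair_pre_digraph" where
  "sigma_graph G =
     \<lparr> pverts = generating_pair_elements G,
       parcs = {(x, y). x \<in> generating_pair_elements G \<and> y \<in> generating_pair_elements G \<and>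
                        x \<noteq> y \<and> generate G {x, y} \<noteq> carrier G} \<rparr>"

lemma pair_graph_sigma_graph:
  assumes "finite (carrier G)"
  shows "pair_graph (sigma_graph G)"
proof -
  have fin: "finite (generating_pair_elements G)"
    using assms by (simp add: generating_pair_elements_def)
  have sub: "parcs (sigma_graph G) \<subseteq> generating_pair_elements G \<times> generating_pair_elements G"
    by (auto simp: sigma_graph_def)
  have fin_arcs: "finite (parcs (sigma_graph G))"
    using finite_subset[OF sub] fin by simp
  have "sym (parcs (sigma_graph G))"
    by (rule symI) (auto simp: sigma_graph_def insert_commute)
  then have sym: "symmetric (with_proj (sigma_graph G))"
    by (simp only: symmetric_def with_proj_simps)
  show ?thesis
    using fin fin_arcs sym by unfold_locales (auto simp: sigma_graph_def)
qed

text \<open>Only out-neighbours are inspected, so this is meant for symmetric digraphs.\<close>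

definition isolated_vertex :: "'a pair_pre_digraph \<Rightarrow> 'a \<Rightarrow> bool" where
  "isolated_vertex H v \<longleftrightarrow> v \<in> pverts H \<and> (\<forall>w\<in>pverts H. (v, w) \<notin> parcs H)"

text \<open>
  The dihedral group with \<open>2 * n\<close> elements (for \<open>n > 0\<close>) as the semidirect product of the integers
  modulo \<open>n\<close> with a group of order two acting by negation. The pair \<open>(a, s)\<close> is the map
  \<open>k \<mapsto> a + k\<close> on the integers modulo \<open>n\<close> if \<open>s\<close> is false, and the reflection
  \<open>k \<mapsto> a - k\<close> if \<open>s\<close> is true; multiplication is composition of these maps.
\<close>

definition dihedral_group :: "nat \<Rightarrow> (int \<times> bool) monoid" where
  "dihedral_group n =
     \<lparr> carrier = carrier (integer_mod_group n) \<times> UNIV,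
       monoid.mult = (\<lambda>(a, s) (b, t). ((if s then a - b else a + b) mod int n, s \<noteq> t)),
       one = (0, False) \<rparr>"

lemma group_dihedral_group: "group (dihedral_group n)"
proof (rule groupI)
  fix x y z
  assume "x \<in> carrier (dihedral_group n)" "y \<in> carrier (dihedral_group n)"
    "z \<in> carrier (dihedral_group n)"
  show "x \<otimes>\<^bsub>dihedral_group n\<^esub> y \<otimes>\<^bsub>dihedral_group n\<^esub> z
      = x \<otimes>\<^bsub>dihedral_group n\<^esub> (y \<otimes>\<^bsub>dihedral_group n\<^esub> z)"
    by (cases x; cases y; cases z;
      simp add: dihedral_group_def mod_simps; simp add: algebra_simps)
next
  fix x
  assume x: "x \<in> carrier (dihedral_group n)"
  obtain a s where as: "x = (a, s)" by (cases x)
  show "\<exists>y\<in>carrier (dihedral_group n). y \<otimes>\<^bsub>dihedral_group n\<^esub> x = \<one>\<^bsub>dihedral_group n\<^esub>"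
  proof (cases s)
    case True
    then show ?thesis
      using x as by (intro bexI[of _ x]) (auto simp: dihedral_group_def)
  next
    case False
    then show ?thesis
      using as by (intro bexI[of _ "((- a) mod int n, False)"])
        (auto simp: dihedral_group_def carrier_integer_mod_group mod_simps)
  qed
qed (auto simp: dihedral_group_def carrier_integer_mod_group split: if_splits)

lemma order_dihedral_group: "n > 0 \<Longrightarrow> order (dihedral_group n) = 2 * n"
  by (simp add: order_def dihedral_group_def carrier_integer_mod_group card_cartesian_product)

end

theory Submission
  imports Defs "HOL-Algebra.Multiplicative_Group"
begin

text \<open>
  Write \<open>\<langle>x, y\<rangle>\<close> for the subgroup generated by \<open>x\<close> and \<open>y\<close>. A vertex \<open>v\<close> is isolated exactly if it
  generates \<open>G\<close> together with every other vertex, so each vertex \<open>w \<noteq> v\<close> that can be built from \<open>v\<close>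
  yields information.

  Let \<open>v\<close> be isolated and \<open>G\<close> not cyclic. The inverse of \<open>v\<close> is a vertex but generates only
  \<open>\<langle>v\<rangle>\<close> with \<open>v\<close>, so it equals \<open>v\<close>, that is, \<open>v\<^sup>2 = 1\<close>. If \<open>G = \<langle>v, y\<rangle>\<close>, then each product
  \<open>v y\<^sup>k\<close> generates \<open>G\<close> with \<open>y\<close> and is hence a vertex; unless \<open>y\<^sup>k = 1\<close>, isolation gives
  \<open>G = \<langle>v, v y\<^sup>k\<rangle> = \<langle>v, y\<^sup>k\<rangle>\<close>. So \<open>y\<close> can be replaced by a power of prime order
  (\<open>isolated_vertex_prime_order_partner\<close>). It remains to arrange that \<open>v\<close> inverts the second
  generator. If \<open>v\<close> and \<open>y\<close> commute, the prime is 2, because otherwise \<open>v y\<close> would generate \<open>G\<close>; then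
  \<open>y\<close> is its own inverse. If they do not commute, the conjugate \<open>w\<close> of \<open>v\<close> by \<open>y\<close> is a vertex
  different from \<open>v\<close>, so \<open>G = \<langle>v, w\<rangle> = \<langle>v, v w\<rangle>\<close>, and \<open>v\<close> inverts the product \<open>v w\<close> of two
  involutions, hence also its powers. A non-cyclic group generated by an involution and an element
  that it inverts is dihedral (\<open>iso_dihedral_group\<close>). Thus \<open>G\<close> is dihedral of order \<open>2 p\<close> with \<open>p\<close>
  prime (\<open>isolated_vertex_imp_dihedral\<close>), and \<open>p = 2\<close> gives the Klein four-group.

  Conversely, a generator of a cyclic group is isolated. In a non-cyclic group of order \<open>2 p\<close>, every
  involution \<open>v\<close> is isolated (\<open>involution_isolated_if_order_twice_prime\<close>): for \<open>w\<close> outside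
  \<open>{1, v}\<close>, the order of \<open>\<langle>v, w\<rangle>\<close> is even, exceeds 2 and divides \<open>2 p\<close>, so by Lagrange it is
  \<open>2 p\<close>.
\<close>

section \<open>Generating pairs and isolated vertices\<close>

lemma (in group) cyclic_group_iff_generate:
  "cyclic_group G \<longleftrightarrow> (\<exists>x\<in>carrier G. generate G {x} = carrier G)"
  unfolding cyclic_group by (intro bex_cong refl) (auto simp: generate_pow)

text \<open>
  Quantifying over all subgroups lets a change of generators be checked by closure properties of
  subgroups alone.
\<close>

lemma (in group) generate_pair_eq_carrierI:
  assumes "generate G {a, b} = carrier G" "x \<in> carrier G" "y \<in> carrier G"
    and "\<And>H. subgroup H G \<Longrightarrow> x \<in> H \<Longrightarrow> y \<in> H \<Longrightarrow> a \<in> H \<and> b \<in> H"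
  shows "generate G {x, y} = carrier G"
proof -
  have sub: "subgroup (generate G {x, y}) G"
    using assms by (intro generate_is_subgroup) auto
  moreover have "x \<in> generate G {x, y}" "y \<in> generate G {x, y}"
    by (auto intro: generate.incl)
  ultimately have "{a, b} \<subseteq> generate G {x, y}"
    using assms(4) by auto
  then have "carrier G \<subseteq> generate G {x, y}"
    using generate_subgroup_incl[OF _ sub] assms(1) by metis
  then show ?thesis
    using subgroup.subset[OF sub] by blast
qed

lemma (in group) cyclic_group_if_generates_pair:
  assumes "generate G {a, b} = carrier G" "x \<in> carrier G"
    and "\<And>H. subgroup H G \<Longrightarrow> x \<in> H \<Longrightarrow> a \<in> H \<and> b \<in> H"
  shows "cyclic_group G"
  using generate_pair_eq_carrierI[of a b x x] assms cyclic_group_iff_generate by auto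

lemma isolated_vertex_sigma_graph_iff:
  "isolated_vertex (sigma_graph G) v \<longleftrightarrow>
     v \<in> generating_pair_elements G \<and>
     (\<forall>w\<in>generating_pair_elements G. w \<noteq> v \<longrightarrow> generate G {v, w} = carrier G)"
  by (auto simp: isolated_vertex_def sigma_graph_def)

section \<open>Groups with an isolated vertex\<close>

text \<open>Otherwise the inverse of \<open>v\<close> would be a neighbour of \<open>v\<close>.\<close>

lemma (in group) isolated_vertex_square_eq_one:
  assumes "\<not> cyclic_group G" "isolated_vertex (sigma_graph G) v"
  shows "v \<otimes> v = \<one>"
proof -
  obtain y where v: "v \<in> carrier G" and y: "y \<in> carrier G" "generate G {v, y} = carrier G"
    using assms(2) by (auto simp: isolated_vertex_sigma_graph_iff generating_pair_elements_def)
  have "v \<in> H" if "subgroup H G" "inv v \<in> H" for H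
    using subgroup.m_inv_closed[OF that] v by simp
  then have "generate G {inv v, y} = carrier G"
    by (intro generate_pair_eq_carrierI[OF y(2) inv_closed[OF v] y(1)] conjI)
  then have "inv v \<in> generating_pair_elements G"
    using v y by (auto simp: generating_pair_elements_def)
  moreover have "generate G {v, inv v} \<noteq> carrier G"
    using cyclic_group_if_generates_pair[of v "inv v" v] v assms(1) subgroup.m_inv_closed by metis
  ultimately have "inv v = v"
    using assms(2) by (auto simp: isolated_vertex_sigma_graph_iff)
  then show ?thesis
    using v l_inv[of v] by simp
qed

lemma (in group) subgroup_nat_pow_closed:
  "subgroup H G \<Longrightarrow> x \<in> H \<Longrightarrow> x [^] (n::nat) \<in> H"
  using subgroup_int_pow_closed[of H x "int n"] by (simp add: int_pow_int)

text \<open>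
  The translate \<open>v y\<^sup>k\<close> is a vertex because it generates the group with \<open>y\<close>; as \<open>v\<close> is isolated, it
  also does so with \<open>v\<close>, and \<open>{v, v y\<^sup>k}\<close> generates the same subgroup as \<open>{v, y\<^sup>k}\<close>.
\<close>

lemma (in group) isolated_vertex_generates_with_power:
  fixes k :: nat
  assumes iso: "isolated_vertex (sigma_graph G) v"
    and y: "y \<in> carrier G" "generate G {v, y} = carrier G" "y [^] k \<noteq> \<one>"
  shows "generate G {v, y [^] k} = carrier G"
proof -
  have v: "v \<in> carrier G"
    using iso by (auto simp: isolated_vertex_sigma_graph_iff generating_pair_elements_def)
  define w where "w = v \<otimes> y [^] k"
  have w: "w \<in> carrier G" "w \<noteq> v"
    using v y by (auto simp: w_def)
  have vH: "v \<in> H" if "subgroup H G" "w \<in> H" "y \<in> H" for H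
  proof -
    have "w \<otimes> inv (y [^] k) \<in> H"
      using that by (intro subgroup.m_closed subgroup.m_inv_closed subgroup_nat_pow_closed)
    then show ?thesis
      using v y by (simp add: w_def m_assoc)
  qed
  have "generate G {w, y} = carrier G"
    by (rule generate_pair_eq_carrierI[OF y(2) w(1) y(1)]) (simp add: vH)
  then have "w \<in> generating_pair_elements G"
    using w y by (auto simp: generating_pair_elements_def)
  then have vw: "generate G {v, w} = carrier G"
    using iso w by (auto simp: isolated_vertex_sigma_graph_iff)
  show ?thesis
    by (rule generate_pair_eq_carrierI[OF vw v nat_pow_closed[OF y(1)]])
      (simp add: w_def subgroup.m_closed)
qed

lemma (in group) isolated_vertex_prime_order_partner:
  assumes fin: "finite (carrier G)" and nc: "\<not> cyclic_group G"
    and iso: "isolated_vertex (sigma_graph G) v"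
    and y: "y \<in> carrier G" "generate G {v, y} = carrier G"
  obtains k :: nat where "prime (ord (y [^] k))" "generate G {v, y [^] k} = carrier G"
proof -
  have v: "v \<in> carrier G"
    using iso by (auto simp: isolated_vertex_sigma_graph_iff generating_pair_elements_def)
  have "y \<noteq> \<one>"
    using nc cyclic_group_if_generates_pair[of v y v] v y by (auto dest: subgroup.one_closed)
  then have "ord y \<noteq> 1"
    using y ord_eq_1 by blast
  then obtain p where p: "prime p" "p dvd ord y"
    using prime_factor_nat by blast
  then obtain k :: nat where k: "ord y = p * k" by (auto elim: dvdE)
  have "ord y > 0"
    using ord_ge_1[OF fin y(1)] by simp
  with k p have "ord (y [^] k) = p"
    using ord_pow[OF y(1), of k] by auto
  moreover from this have "y [^] k \<noteq> \<one>"
    using p by auto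
  ultimately show ?thesis
    using that[of k] p isolated_vertex_generates_with_power[OF iso y] by simp
qed

text \<open>
  With \<open>n\<close> the odd order of \<open>y\<close>, the power \<open>(v y)\<^sup>n = v\<^sup>n y\<^sup>n\<close> equals \<open>v\<close>. So \<open>\<langle>v y\<rangle>\<close> contains \<open>v\<close>,
  and therefore also \<open>y\<close>.
\<close>

lemma (in group) cyclic_group_if_commuting_odd_order:
  assumes "v \<in> carrier G" "y \<in> carrier G" "generate G {v, y} = carrier G"
    and "v \<otimes> v = \<one>" "v \<otimes> y = y \<otimes> v" "odd (ord y)"
  shows "cyclic_group G"
proof (rule cyclic_group_if_generates_pair[OF assms(3)])
  show "v \<otimes> y \<in> carrier G" using assms by simp
  fix H assume H: "subgroup H G" "v \<otimes> y \<in> H"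
  obtain m where m: "ord y = Suc (2 * m)"
    using assms(6) by (auto elim: oddE)
  have "v [^] (2 * m) = (v [^] (2::nat)) [^] m"
    using assms by (simp add: nat_pow_pow)
  then have "v [^] ord y = v"
    using assms m by (simp add: numeral_2_eq_2)
  moreover have "(v \<otimes> y) [^] ord y = v [^] ord y \<otimes> y [^] ord y"
    using assms by (simp add: pow_mult_distrib)
  ultimately have "v = (v \<otimes> y) [^] ord y"
    using assms by simp
  then have vH: "v \<in> H"
    using H subgroup_nat_pow_closed by metis
  then have "v \<otimes> (v \<otimes> y) \<in> H"
    using H by (simp add: subgroup.m_closed[OF H(1)])
  moreover have "v \<otimes> (v \<otimes> y) = y"
    using assms(1,2,4) by (simp flip: m_assoc)
  ultimately show "v \<in> H \<and> y \<in> H"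
    using vH by simp
qed

lemma (in group) inverting_element_mult_int_pow:
  assumes "v \<in> carrier G" "r \<in> carrier G" "v \<otimes> r = inv r \<otimes> v"
  shows "v \<otimes> r [^] (i::int) = r [^] (- i) \<otimes> v"
proof -
  have nat: "v \<otimes> x [^] n = inv x [^] n \<otimes> v"
    if "x \<in> carrier G" "v \<otimes> x = inv x \<otimes> v" for x and n :: nat
  proof (induction n)
    case (Suc n)
    have "v \<otimes> x [^] Suc n = v \<otimes> x [^] n \<otimes> x"
      using that(1) assms(1) by (simp add: m_assoc)
    also have "\<dots> = inv x [^] n \<otimes> (v \<otimes> x)"
      unfolding Suc using that(1) assms(1) by (simp add: m_assoc)
    also have "\<dots> = inv x [^] Suc n \<otimes> v"
      unfolding that(2) using that(1) assms(1) by (simp add: m_assoc)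
    finally show ?case .
  qed (use assms in simp)
  have "r \<otimes> v = r \<otimes> (v \<otimes> r) \<otimes> inv r"
    using assms(1,2) by (simp add: m_assoc)
  also have "\<dots> = v \<otimes> inv r"
    unfolding assms(3) using assms(1,2) by (simp flip: m_assoc)
  finally have "v \<otimes> inv r = r \<otimes> v" ..
  with nat[of "inv r"] nat[of r] assms show ?thesis
    by (cases i rule: int_cases2) (auto simp: int_pow_neg int_pow_int nat_pow_inv)
qed

text \<open>
  The relations let every element be written as \<open>r\<^sup>a\<close> or \<open>r\<^sup>a v\<close>, which gives a homomorphism from the
  dihedral group onto \<open>G\<close>. Its kernel contains no reflection, since \<open>r\<^sup>a v = 1\<close> would put
  \<open>v\<close> into \<open>\<langle>r\<rangle>\<close> and make \<open>G\<close> cyclic. The Klein four-group is covered, with \<open>r\<close> of order 2.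
\<close>

lemma (in group) iso_dihedral_group:
  assumes nc: "\<not> cyclic_group G" and q: "ord r > 0"
    and v: "v \<in> carrier G" and r: "r \<in> carrier G" and gen: "generate G {v, r} = carrier G"
    and vv: "v \<otimes> v = \<one>" and vr: "v \<otimes> r = inv r \<otimes> v"
  shows "G \<cong> dihedral_group (ord r)"
proof -
  let ?D = "dihedral_group (ord r)"
  define h where "h = (\<lambda>(a::int, s). r [^] a \<otimes> (if s then v else \<one>))"
  have D: "carrier ?D = {0..<int (ord r)} \<times> UNIV"
    using q by (simp add: dihedral_group_def carrier_integer_mod_group)
  have pow_mod: "r [^] (a mod int (ord r)) = r [^] a" for a :: int
    using r int_pow_eq[of r "a mod int (ord r)" a] by (simp add: mod_eq_dvd_iff[symmetric])
  note move = inverting_element_mult_int_pow[OF v r vr]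
  have move_assoc: "v \<otimes> (r [^] b \<otimes> x) = r [^] (- b) \<otimes> (v \<otimes> x)" if "x \<in> carrier G" for b :: int and x
    using move[of b] v r that by (simp flip: m_assoc)
  have hom: "h \<in> hom ?D G"
  proof (rule homI)
    fix x assume "x \<in> carrier ?D" then show "h x \<in> carrier G"
      using v r by (auto simp: h_def split: prod.splits)
  next
    fix x y assume "x \<in> carrier ?D" "y \<in> carrier ?D"
    obtain a s b t where "x = (a, s)" "y = (b, t)" by (cases x, cases y) auto
    moreover have "r [^] a \<otimes> (r [^] b \<otimes> z) = r [^] (a + b) \<otimes> z"
        if "z \<in> carrier G" for a b :: int and z
      using that r by (simp add: int_pow_mult m_assoc)
    ultimately show "h (x \<otimes>\<^bsub>?D\<^esub> y) = h x \<otimes> h y"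
      using v r vv by (auto simp: h_def dihedral_group_def pow_mod m_assoc move move_assoc int_pow_mult
        int_pow_diff int_pow_neg)
  qed
  interpret D: group ?D by (rule group_dihedral_group)
  interpret h: group_hom ?D G h
    by unfold_locales (rule hom)
  \<comment> \<open>This makes \<open>1\<close> a reduced residue, so that \<open>(1, False)\<close> lies in the dihedral group.\<close>
  have ord1: "ord r \<noteq> 1"
    using nc cyclic_group_if_generates_pair[OF gen v] r ord_eq_1[of r] by (auto dest: subgroup.one_closed)
  have "h ` carrier ?D = carrier G"
  proof -
    have "h (0, True) = v" "h (1, False) = r"
      using v r by (auto simp: h_def int_pow_1)
    moreover have "(0, True) \<in> carrier ?D" "(1, False) \<in> carrier ?D"
      using q ord1 by (auto simp: D)
    ultimately have "{v, r} \<subseteq> h ` carrier ?D"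
      by (metis empty_subsetI image_eqI insert_subset)
    then have "generate G {v, r} \<subseteq> h ` carrier ?D"
      by (rule generate_subgroup_incl[OF _ h.img_is_subgroup])
    then show ?thesis
      using gen h.hom_closed by auto
  qed
  moreover have "x = \<one>\<^bsub>?D\<^esub>" if "x \<in> carrier ?D" "h x = \<one>" for x
  proof -
    obtain a s where x: "x = (a, s)" by (cases x)
    show ?thesis
    proof (cases s)
      case True
      have "v = r [^] (- a)"
        using that True x r v by (simp add: h_def int_pow_neg) (metis inv_equality inv_inv int_pow_closed)
      then have "cyclic_group G"
        using cyclic_group_if_generates_pair[OF gen r] subgroup_int_pow_closed by metis
      then show ?thesis using nc by simp
    next
      case False
      then have "int (ord r) dvd a"
        using that x r by (simp add: h_def int_pow_eq_id)
      then have "a = 0"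
        using that x by (auto simp: D dest: zdvd_imp_le)
      then show ?thesis using False x by (simp add: dihedral_group_def)
    qed
  qed
  ultimately have "h \<in> iso ?D G"
    using hom h.inj_on_one_iff by (auto simp: iso_iff)
  then show ?thesis
    using D.iso_sym is_isoI by blast
qed

text \<open>
  Both cases lead to the same presentation: \<open>v\<close> inverts a second generator of prime order. When
  \<open>v\<close> commutes with its partner, that generator has order 2; otherwise it is a power of the
  product of \<open>v\<close> with a conjugate of \<open>v\<close>.
\<close>

lemma (in group) isolated_vertex_imp_dihedral:
  assumes fin: "finite (carrier G)" and nc: "\<not> cyclic_group G"
    and iso: "isolated_vertex (sigma_graph G) v"
  obtains p where "prime p" "G \<cong> dihedral_group p"
proof -
  obtain y where v: "v \<in> carrier G" and y: "y \<in> carrier G" "generate G {v, y} = carrier G"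
    using iso by (auto simp: isolated_vertex_sigma_graph_iff generating_pair_elements_def)
  have vv: "v \<otimes> v = \<one>"
    by (rule isolated_vertex_square_eq_one[OF nc iso])
  then have inv_v: "inv v = v"
    using v inv_equality by blast
  have "\<exists>r\<in>carrier G. prime (ord r) \<and> generate G {v, r} = carrier G \<and> v \<otimes> r = inv r \<otimes> v"
  proof (cases "v \<otimes> y = y \<otimes> v")
    case True
    obtain k :: nat where k: "prime (ord (y [^] k))" "generate G {v, y [^] k} = carrier G"
      using isolated_vertex_prime_order_partner[OF fin nc iso y] .
    define r where "r = y [^] k"
    have r: "r \<in> carrier G" using y by (simp add: r_def)
    have comm: "v \<otimes> r = r \<otimes> v"
      using True v y by (simp add: r_def group_commutes_pow[of y v])
    have "even (ord r)"
      using cyclic_group_if_commuting_odd_order[OF v r _ vv comm] k nc by (auto simp: r_def)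
    then have "ord r = 2"
      using primes_dvd_imp_eq[OF two_is_prime_nat] k(1) by (metis r_def)
    then have "r \<otimes> r = \<one>"
      using pow_ord_eq_1[OF r] r by (simp add: numeral_2_eq_2)
    then have "inv r = r"
      using r inv_equality by blast
    then show ?thesis
      using k r comm by (auto simp: r_def)
  next
    case False
    define w where "w = y \<otimes> v \<otimes> inv y"
    have w: "w \<in> carrier G" using v y by (simp add: w_def)
    have "w \<otimes> y = y \<otimes> v"
      using v y by (simp add: w_def m_assoc)
    then have "w \<noteq> v"
      using False by auto
    have conj: "inv y \<otimes> w \<otimes> y = v"
      using v y by (simp add: w_def m_assoc) (simp flip: m_assoc)
    have "v \<in> H" if "subgroup H G" "w \<in> H" "y \<in> H" for H
      unfolding conj[symmetric] using that
      by (intro subgroup.m_closed subgroup.m_inv_closed)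
    then have "generate G {w, y} = carrier G"
      by (intro generate_pair_eq_carrierI[OF y(2) w y(1)] conjI)
    then have gvw: "generate G {v, w} = carrier G"
      using iso w y \<open>w \<noteq> v\<close>
      by (auto simp: isolated_vertex_sigma_graph_iff generating_pair_elements_def)
    define s where "s = v \<otimes> w"
    have s: "s \<in> carrier G" using v w by (simp add: s_def)
    have vs: "v \<otimes> s = w" using v w vv by (simp add: s_def flip: m_assoc)
    have "w \<in> H" if "subgroup H G" "v \<in> H" "s \<in> H" for H
      unfolding vs[symmetric] using that by (rule subgroup.m_closed)
    then have "generate G {v, s} = carrier G"
      by (intro generate_pair_eq_carrierI[OF gvw v s] conjI)
    then obtain k :: nat where k: "prime (ord (s [^] k))" "generate G {v, s [^] k} = carrier G"
      using isolated_vertex_prime_order_partner[OF fin nc iso s] by metis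
    have "inv w = w"
      using v y inv_v by (simp add: w_def inv_mult_group m_assoc)
    then have "inv s \<otimes> v = w"
      using v w inv_v vv by (simp add: s_def inv_mult_group m_assoc)
    then have "v \<otimes> s [^] int k = s [^] (- int k) \<otimes> v"
      using vs by (intro inverting_element_mult_int_pow v s) simp
    then have "v \<otimes> s [^] k = inv (s [^] k) \<otimes> v"
      using s by (simp add: int_pow_neg int_pow_int)
    then show ?thesis
      using k s by blast
  qed
  then obtain r where r: "r \<in> carrier G" "prime (ord r)" "generate G {v, r} = carrier G"
      "v \<otimes> r = inv r \<otimes> v"
    by blast
  then have "G \<cong> dihedral_group (ord r)"
    using nc v vv by (intro iso_dihedral_group) (auto intro: prime_gt_0_nat)
  with r that show ?thesis by blast
qed

section \<open>Groups of order twice a prime\<close>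

lemma dihedral_group_2_iso: "dihedral_group 2 \<cong> integer_mod_group 2 \<times>\<times> integer_mod_group 2"
proof (rule is_isoI)
  have two: "{0..<2::int} = {0, 1}" by auto
  show "(\<lambda>(a, s). (a, of_bool s)) \<in> iso (dihedral_group 2) (integer_mod_group 2 \<times>\<times> integer_mod_group 2)"
    by (auto simp: iso_iff hom_def dihedral_group_def carrier_integer_mod_group two inj_on_def
      image_iff split: if_splits)
qed

text \<open>
  A reflection generates a subgroup of order 2, and a rotation generates a subgroup that contains no
  reflection. This argument treats the abelian group with \<open>n = 2\<close> together with the others.
\<close>

lemma not_cyclic_dihedral_group:
  assumes "n \<ge> 2"
  shows "\<not> cyclic_group (dihedral_group n)"
proof
  let ?D = "dihedral_group n"
  interpret D: group ?D by (rule group_dihedral_group)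
  have D: "carrier ?D = {0..<int n} \<times> UNIV"
    using assms by (simp add: dihedral_group_def carrier_integer_mod_group)
  assume "cyclic_group ?D"
  then obtain x where x: "x \<in> carrier ?D" "generate ?D {x} = carrier ?D"
    using D.cyclic_group_iff_generate by blast
  obtain a s where as: "x = (a, s)" by (cases x)
  have min: "carrier ?D \<subseteq> H" if "subgroup H ?D" "x \<in> H" for H
    using D.generate_subgroup_incl[of "{x}" H] that x by auto
  show False
  proof (cases s)
    case True
    have xx: "x \<otimes>\<^bsub>?D\<^esub> x = \<one>\<^bsub>?D\<^esub>"
      using as True by (simp add: dihedral_group_def)
    then have "inv\<^bsub>?D\<^esub> x = x"
      using x D.inv_equality by blast
    then have "subgroup {\<one>\<^bsub>?D\<^esub>, x} ?D"
      using x xx by (intro D.subgroupI) auto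
    then have "card (carrier ?D) \<le> card {\<one>\<^bsub>?D\<^esub>, x}"
      using min by (intro card_mono) auto
    also have "\<dots> \<le> 2" by (simp add: card_insert_if)
    finally show False
      using order_dihedral_group[of n] assms by (simp add: order_def)
  next
    case False
    define R where "R = {0..<int n} \<times> {False}"
    have "subgroup R ?D"
    proof (intro D.subgroupI)
      show "R \<subseteq> carrier ?D" "R \<noteq> {}"
        using assms by (auto simp: R_def D)
    next
      fix u assume u: "u \<in> R"
      then have "inv\<^bsub>?D\<^esub> u = ((- fst u) mod int n, False)"
        using assms by (intro D.inv_equality) (auto simp: R_def dihedral_group_def mod_simps carrier_integer_mod_group)
      then show "inv\<^bsub>?D\<^esub> u \<in> R" using assms by (simp add: R_def)
    qed (use assms in \<open>auto simp: R_def dihedral_group_def\<close>)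
    moreover have "x \<in> R" using x as False by (auto simp: R_def D)
    ultimately have "carrier ?D \<subseteq> R" by (rule min)
    moreover have "(0, True) \<in> carrier ?D" using assms by (simp add: D)
    ultimately show False by (auto simp: R_def)
  qed
qed

text \<open>
  For \<open>w\<close> other than \<open>1\<close> and \<open>v\<close>, Lagrange's theorem leaves no room for \<open>\<langle>v, w\<rangle>\<close> to be proper: its
  order is even because of \<open>v\<close>, at least 3 because of \<open>w\<close>, and divides \<open>2 p\<close>. The neutral element
  is not a vertex, since a partner of it would generate the group alone.
\<close>

lemma (in group) involution_isolated_if_order_twice_prime:
  assumes p: "prime p" and ord: "order G = 2 * p" and nc: "\<not> cyclic_group G"
    and v: "v \<in> carrier G" "v \<noteq> \<one>" "v \<otimes> v = \<one>"
  shows "isolated_vertex (sigma_graph G) v"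
proof -
  have fin: "finite (carrier G)"
    using ord p order_gt_0_iff_finite by (simp add: prime_gt_0_nat)
  have gen: "generate G {v, w} = carrier G" if w: "w \<in> carrier G" "w \<noteq> \<one>" "w \<noteq> v" for w
  proof -
    let ?H = "generate G {v, w}"
    have sub: "subgroup ?H G"
      using v w by (intro generate_is_subgroup) auto
    interpret H: group "G\<lparr>carrier := ?H\<rparr>"
      using sub by (rule subgroup.subgroup_is_group) (rule group_axioms)
    have in_H: "v \<in> ?H" "w \<in> ?H" "\<one> \<in> ?H"
      by (auto intro: generate.incl generate.one)
    have "inv v = v"
      using v inv_equality by blast
    then have "inv\<^bsub>G\<lparr>carrier := ?H\<rparr>\<^esub> v = v"
      using in_H v by (intro H.inv_equality) auto
    then have "subgroup {\<one>, v} (G\<lparr>carrier := ?H\<rparr>)"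
      using in_H v H.inv_one by (intro H.subgroupI) auto
    then have "card {\<one>, v} dvd order (G\<lparr>carrier := ?H\<rparr>)"
      by (metis H.lagrange dvd_triv_right)
    then have "2 dvd card ?H"
      using v by (simp add: order_def numeral_2_eq_2)
    then obtain k where k: "card ?H = 2 * k" by (elim dvdE)
    have "card ?H dvd 2 * p"
      using lagrange[OF sub] ord by (metis dvd_triv_right)
    then have "k dvd p" using k by simp
    moreover have "card {\<one>, v, w} \<le> card ?H"
      using in_H finite_subset[OF subgroup.subset[OF sub] fin] by (intro card_mono) auto
    then have "k \<noteq> 1"
      using v w k by auto
    ultimately have "k = p"
      using p by (auto simp: prime_nat_iff)
    then show ?thesis
      using k ord fin subgroup.subset[OF sub] by (intro card_subset_eq) (auto simp: order_def)
  qed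
  have "\<not> carrier G \<subseteq> {\<one>, v}"
  proof
    assume "carrier G \<subseteq> {\<one>, v}"
    then have "order G \<le> card {\<one>, v}"
      unfolding order_def by (intro card_mono) auto
    then show False
      using ord prime_ge_2_nat[OF p] v by simp
  qed
  then obtain w where "w \<in> carrier G" "w \<noteq> \<one>" "w \<noteq> v" by blast
  then have "v \<in> generating_pair_elements G"
    using gen v by (auto simp: generating_pair_elements_def)
  moreover have "\<one> \<notin> generating_pair_elements G"
  proof
    assume "\<one> \<in> generating_pair_elements G"
    then obtain y where "y \<in> carrier G" "generate G {\<one>, y} = carrier G"
      by (auto simp: generating_pair_elements_def)
    then show False
      using nc cyclic_group_if_generates_pair[of \<one> y y] by (auto dest: subgroup.one_closed)
  qed
  ultimately show ?thesis
    using gen by (auto simp: isolated_vertex_sigma_graph_iff generating_pair_elements_def)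
qed

section \<open>The classification\<close>

lemma (in group) cyclic_imp_isolated_vertex:
  assumes "cyclic_group G"
  shows "\<exists>v. isolated_vertex (sigma_graph G) v"
proof -
  obtain x where x: "x \<in> carrier G" "generate G {x} = carrier G"
    using assms cyclic_group_iff_generate by blast
  have xx: "generate G {x, x} = carrier G"
    using x(2) by simp
  have "generate G {x, w} = carrier G" if "w \<in> carrier G" for w
    by (rule generate_pair_eq_carrierI[OF xx x(1) that]) simp
  then have "isolated_vertex (sigma_graph G) x"
    using x by (auto simp: isolated_vertex_sigma_graph_iff generating_pair_elements_def)
  then show ?thesis ..
qed

lemma (in group) dihedral_imp_isolated_vertex:
  assumes p: "prime p" and iso: "G \<cong> dihedral_group p"
  shows "\<exists>v. isolated_vertex (sigma_graph G) v"
proof -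
  let ?D = "dihedral_group p"
  note p2 = prime_ge_2_nat[OF p]
  interpret D: group ?D by (rule group_dihedral_group)
  obtain h where h: "h \<in> iso ?D G"
    using iso_sym[OF iso] by (auto simp: is_iso_def)
  interpret h: group_hom ?D G h
    using h by unfold_locales (simp add: iso_def)
  have t: "(0, True) \<in> carrier ?D" "(0, True) \<otimes>\<^bsub>?D\<^esub> (0, True) = \<one>\<^bsub>?D\<^esub>" "(0, True) \<noteq> \<one>\<^bsub>?D\<^esub>"
    using p2 by (auto simp: dihedral_group_def carrier_integer_mod_group)
  have "isolated_vertex (sigma_graph G) (h (0, True))"
  proof (rule involution_isolated_if_order_twice_prime[OF p])
    show "order G = 2 * p"
      using iso_same_card[OF iso] order_dihedral_group[of p] p2 by (simp add: order_def)
    show "\<not> cyclic_group G"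
      using isomorphic_group_cyclicity[OF iso is_group D.is_group] not_cyclic_dihedral_group[OF p2]
      by simp
    show "h (0, True) \<in> carrier G" using t by simp
    show "h (0, True) \<otimes> h (0, True) = \<one>"
      using t h.hom_mult[of "(0, True)" "(0, True)"] by simp
    show "h (0, True) \<noteq> \<one>"
      using t h h.inj_on_one_iff by (auto simp: iso_iff)
  qed
  then show ?thesis ..
qed

theorem proposition2:
  fixes G :: "('a, 'b) monoid_scheme"
  assumes "group G"
    and "finite (carrier G)"
    and "two_generated G"
  shows "(\<exists>v. isolated_vertex (sigma_graph G) v) \<longleftrightarrow>
      cyclic_group G \<or>
      G \<cong> integer_mod_group 2 \<times>\<times> integer_mod_group 2 \<or>
      (\<exists>p::nat. prime p \<and> odd p \<and> G \<cong> dihedral_group p)"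
    (is "?isolated \<longleftrightarrow> ?cyclic \<or> ?klein \<or> ?dihedral")
proof -
  interpret group G by (rule assms(1))
  have klein: "?klein \<longleftrightarrow> G \<cong> dihedral_group 2"
    using dihedral_group_2_iso iso_trans group.iso_sym[OF group_dihedral_group] by metis
  then have "?klein \<or> ?dihedral \<longleftrightarrow> (\<exists>p::nat. prime p \<and> G \<cong> dihedral_group p)"
    by (metis primes_dvd_imp_eq two_is_prime_nat)
  moreover have "?isolated \<longleftrightarrow> ?cyclic \<or> (\<exists>p::nat. prime p \<and> G \<cong> dihedral_group p)"
    using isolated_vertex_imp_dihedral[OF assms(2)] cyclic_imp_isolated_vertex
      dihedral_imp_isolated_vertex by metis
  ultimately show ?thesis by simp
qed

end
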